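(* Let $\mathcal H$ be a finite-dimensional complex Hilbert space with a fixed computational (orthonormal) basis, $d=\dim\mathcal H$, let $\widetilde P:\mathcal L(\mathcal H)\to\mathcal L(\mathcal H)$ be a linear map with $\widetilde P^2=\widetilde P$ that is self-adjoint ($\widetilde P=\widetilde P^\dagger$), unital ($\widetilde P[\mathbb 1]=\mathbb 1$) and commutes with transposition ($\widetilde P[W^\tau]=\widetilde P[W]^\tau$ for all $W\in\mathcal L(\mathcal H)$), let $\gamma\in\mathbb R$ with $\gamma\neq0$, and let $$\mathcal S=\{W\in\mathcal L(\mathcal H):\widetilde P[W]=W,\ \operatorname{tr}[W]=\gamma\}.$$ Then an operator $\overline W\in\mathcal L(\mathcal H)$ belongs to the dual affine set $\overline{\mathcal S}$ of $\mathcal S$ if and only if $$\overline W=\overline W-\widetilde P[\overline W]+\operatorname{tr}[\overline W]\,\frac{\mathbb 1}{d}\qquad\text{and}\qquad \operatorname{tr}[\overline W]=\frac d\gamma .$$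
   Context: $\mathcal L(\mathcal H)$ is the space of linear operators on $\mathcal H$. The dual affine set of $\mathcal S\subseteq\mathcal L(\mathcal H)$ is $\overline{\mathcal S}=\{\overline W\in\mathcal L(\mathcal H):\operatorname{tr}[\overline W^\dagger W]=1\ \text{for all }W\in\mathcal S\}$. $\tau$ is transposition in the computational basis. The adjoint $\widetilde P^\dagger$ is defined by $\operatorname{tr}[B^\dagger\widetilde P[A]]=\operatorname{tr}[\widetilde P^\dagger[B]^\dagger A]$ for all $A,B\in\mathcal L(\mathcal H)$. *)

theory Defs
  imports "HOL-Analysis.Analysis"
begin

text \<open>
  An operator on a Hilbert space of dimension \<open>CARD('n)\<close> is given by its matrix with respect
  to the fixed orthonormal computational basis, indexed by \<open>'n\<close>.  Transposition in that basis
  is the library's \<^const>\<open>transpose\<close>, and the identity operator is \<open>mat 1\<close>.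
\<close>

text \<open>
  On \<open>complex^'n^'n\<close> the library only has scalar multiplication by reals (\<open>*\<^sub>R\<close>);
  complex-linear maps need multiplication by complex scalars.
\<close>

definition cscale :: "complex \<Rightarrow> complex^'n^'m \<Rightarrow> complex^'n^'m"  (infixr \<open>*\<^sub>C\<close> 75)
  where "c *\<^sub>C A = map_matrix (\<lambda>z. c * z) A"

lemma cscale_nth [simp]: "(c *\<^sub>C A) $ i $ j = c * A $ i $ j"
  by (simp add: cscale_def)

lemma vector_space_cscale: "vector_space (cscale :: complex \<Rightarrow> complex^'n^'m \<Rightarrow> complex^'n^'m)"
  by unfold_locales (simp_all add: vec_eq_iff algebra_simps)

definition complex_linear :: "(complex^'n^'n \<Rightarrow> complex^'n^'n) \<Rightarrow> bool"
  where "complex_linear P \<longleftrightarrow> Vector_Spaces.linear cscale cscale P"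

lemma complex_linear_iff:
  "complex_linear P \<longleftrightarrow> (\<forall>A B. P (A + B) = P A + P B) \<and> (\<forall>c A. P (c *\<^sub>C A) = c *\<^sub>C P A)"
  unfolding complex_linear_def Vector_Spaces.linear_def module_hom_def module_hom_axioms_def
  using vector_space_cscale vector_space_cscale[unfolded module_iff_vector_space[symmetric]]
  by auto

definition dagger :: "complex^'n^'m \<Rightarrow> complex^'m^'n"
  where "dagger A = map_matrix cnj (transpose A)"

lemma dagger_nth [simp]: "dagger A $ i $ j = cnj (A $ j $ i)"
  by (simp add: dagger_def transpose_def)

lemma dagger_dagger [simp]: "dagger (dagger A) = A"
  by (simp add: vec_eq_iff)

definition map_adjoint ::
    "(complex^'n^'n \<Rightarrow> complex^'n^'n) \<Rightarrow> (complex^'n^'n \<Rightarrow> complex^'n^'n)"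
  where "map_adjoint P = (THE Q. \<forall>A B. trace (dagger B ** P A) = trace (dagger (Q B) ** A))"

definition dual_affine :: "(complex^'n^'n) set \<Rightarrow> (complex^'n^'n) set"
  where "dual_affine S = {V. \<forall>W\<in>S. trace (dagger V ** W) = 1}"

text \<open>For a complex-linear map the description in \<^const>\<open>map_adjoint\<close> is satisfied by exactly one \<open>Q\<close>.\<close>

lemma trace_dagger_mult: "trace (dagger A ** B) = (\<Sum>j\<in>UNIV. \<Sum>i\<in>UNIV. cnj (A $ i $ j) * B $ i $ j)"
  by (simp add: trace_def matrix_matrix_mult_def)

lemma trace_dagger_unit:
  "trace (dagger A ** (\<chi> k l. if k = i \<and> l = j then 1 else 0)) = cnj (A $ i $ j)"
proof -
  have "trace (dagger A ** (\<chi> k l. if k = i \<and> l = j then 1 else 0))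
      = (\<Sum>l\<in>UNIV. \<Sum>k\<in>UNIV. if k = i then (if l = j then cnj (A $ k $ l) else 0) else 0)"
    unfolding trace_dagger_mult by (intro sum.cong refl) auto
  then show ?thesis by simp
qed

lemma ex1_map_adjoint:
  fixes P :: "complex^'n^'n \<Rightarrow> complex^'n^'n"
  assumes "complex_linear P"
  shows "\<exists>!Q. \<forall>A B. trace (dagger B ** P A) = trace (dagger (Q B) ** A)"
proof -
  interpret hom: Vector_Spaces.linear cscale cscale P
    using assms by (simp add: complex_linear_def)
  define E :: "'n \<Rightarrow> 'n \<Rightarrow> complex^'n^'n"
    where "E i j = (\<chi> k l. if k = i \<and> l = j then 1 else 0)" for i j
  define Q where "Q B = (\<chi> i j. cnj (trace (dagger B ** P (E i j))))" for B
  have decomp: "A = (\<Sum>j\<in>UNIV. \<Sum>i\<in>UNIV. (A $ i $ j) *\<^sub>C E i j)" for A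
  proof -
    have "(\<Sum>j\<in>UNIV. \<Sum>i\<in>UNIV. A $ i $ j * (if k = i \<and> l = j then 1 else 0))
        = (\<Sum>j\<in>UNIV. \<Sum>i\<in>UNIV. if k = i then (if l = j then A $ i $ j else 0) else 0)" for k l
      by (intro sum.cong refl) auto
    then show ?thesis by (simp add: vec_eq_iff E_def)
  qed
  have tr_sum: "trace (dagger B ** (\<Sum>x\<in>X. f x)) = (\<Sum>x\<in>X. trace (dagger B ** f x))"
    if "finite X" for B and X :: "'n set" and f :: "'n \<Rightarrow> complex^'n^'n"
    using that by (induction X) (simp_all add: matrix_add_ldistrib trace_add trace_def[of 0])
  have tr_scale: "trace (dagger B ** (c *\<^sub>C A)) = c * trace (dagger B ** A)"
    for A B :: "complex^'n^'n" and c
    by (simp add: trace_dagger_mult sum_distrib_left mult.left_commute)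
  have Q: "trace (dagger B ** P A) = trace (dagger (Q B) ** A)" for A B
  proof -
    have "P A = (\<Sum>j\<in>UNIV. \<Sum>i\<in>UNIV. (A $ i $ j) *\<^sub>C P (E i j))"
      by (subst decomp) (simp add: hom.sum hom.scale)
    then show ?thesis
      by (simp add: tr_sum tr_scale trace_dagger_mult[of "\<chi> i j. _ i j"] Q_def mult.commute)
  qed
  show ?thesis
  proof (rule ex1I[of _ Q])
    show "\<forall>A B. trace (dagger B ** P A) = trace (dagger (Q B) ** A)"
      using Q by blast
  next
    fix R
    assume R: "\<forall>A B. trace (dagger B ** P A) = trace (dagger (R B) ** A)"
    have "cnj (R B $ i $ j) = cnj (Q B $ i $ j)" for B i j
      using R Q by (metis trace_dagger_unit)
    then show "R = Q" by (simp add: fun_eq_iff vec_eq_iff)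
  qed
qed

end

theory Submission
  imports Defs
begin

text \<open>
  Write \<open>\<langle>A, B\<rangle> = tr (A\<^sup>\<dagger> B)\<close>, so that \<open>P\<close> is an orthogonal projection. Both conditions together
  say \<open>P V = 1 / \<gamma>\<close> (times the identity). Given this, \<open>\<langle>V, W\<rangle> = \<langle>P V, W\<rangle> = tr W / \<gamma> = 1\<close> on \<open>S\<close>.
  Conversely, testing \<open>V\<close> on the multiple \<open>W\<^sub>0\<close> of the identity lying in \<open>S\<close> gives \<open>tr V = d / \<gamma>\<close>. Then
  \<open>X = P V - 1 / \<gamma>\<close> is a traceless fixed point of \<open>P\<close>, so \<open>W\<^sub>0 + X \<in> S\<close> and hence \<open>\<langle>V, X\<rangle> = 0\<close>,
  which forces \<open>\<langle>X, X\<rangle> = \<langle>P V, X\<rangle> = \<langle>V, X\<rangle> = 0\<close>.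
\<close>

lemma trace_mult_cscale: "trace (A ** (c *\<^sub>C B)) = c * trace (A ** B)"
  by (simp add: trace_def matrix_matrix_mult_def sum_distrib_left mult.left_commute)

lemma trace_cscale: "trace (c *\<^sub>C A) = c * trace A"
  by (simp add: trace_def sum_distrib_left)

lemma dagger_mat_1 [simp]: "dagger (mat 1) = mat 1"
  by (simp add: vec_eq_iff mat_def)

lemma trace_dagger_add_mult:
  "trace (dagger (A + B) ** C) = trace (dagger A ** C) + trace (dagger B ** C)"
  by (simp add: trace_dagger_mult algebra_simps sum.distrib)

lemma trace_dagger: "trace (dagger A) = cnj (trace A)"
  by (simp add: trace_def)

lemma trace_dagger_cscale_mult: "trace (dagger (c *\<^sub>C A) ** B) = cnj c * trace (dagger A ** B)"
  by (simp add: trace_dagger_mult sum_distrib_left mult.assoc)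

text \<open>Positive definiteness: the trace is the sum of the squared moduli of the
  entries.\<close>

lemma trace_dagger_self_eq_0_iff: "trace (dagger A ** A) = 0 \<longleftrightarrow> A = 0"
proof
  assume "trace (dagger A ** A) = 0"
  then have "Re (\<Sum>j\<in>UNIV. \<Sum>i\<in>UNIV. cnj (A $ i $ j) * A $ i $ j) = 0"
    by (simp add: trace_dagger_mult)
  moreover have "Re (cnj z * z) = (cmod z)\<^sup>2" for z
    unfolding cmod_power2 by (simp add: power2_eq_square)
  ultimately have "(\<Sum>j\<in>UNIV. \<Sum>i\<in>UNIV. (cmod (A $ i $ j))\<^sup>2) = 0"
    by (simp only: Re_sum)
  then show "A = 0"
    by (simp add: sum_nonneg_eq_0_iff sum_nonneg vec_eq_iff)
qed (simp add: trace_def)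

lemma map_adjoint_trace:
  assumes "complex_linear P"
  shows "trace (dagger B ** P A) = trace (dagger (map_adjoint P B) ** A)"
  using theI'[OF ex1_map_adjoint[OF assms]] unfolding map_adjoint_def by blast

theorem theorem3:
  fixes P :: "complex^'n^'n \<Rightarrow> complex^'n^'n"
    and \<gamma> :: real
    and S :: "(complex^'n^'n) set"
    and V :: "complex^'n^'n"
  assumes linear: "complex_linear P"
    and idempotent: "P \<circ> P = P"
    and self_adjoint: "P = map_adjoint P"
    and unital: "P (mat 1) = mat 1"
    and transposition: "\<forall>W. P (transpose W) = transpose (P W)"
    and gamma: "\<gamma> \<noteq> 0"
    and S: "S = {W. P W = W \<and> trace W = of_real \<gamma>}"
  shows "V \<in> dual_affine S \<longleftrightarrow>
      V = V - P V + (trace V / of_nat CARD('n)) *\<^sub>C mat 1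
      \<and> trace V = of_nat CARD('n) / of_real \<gamma>"
proof -
  let ?d = "of_nat CARD('n) :: complex"
  have adj: "trace (dagger B ** P A) = trace (dagger (P B) ** A)" for A B
    using map_adjoint_trace[OF linear, of B A] self_adjoint by simp
  have add: "P (A + B) = P A + P B" and scale: "P (c *\<^sub>C A) = c *\<^sub>C P A" for A B c
    using linear by (auto simp: complex_linear_iff)
  have trace_1: "trace (mat 1 :: complex^'n^'n) = ?d"
    by (simp add: trace_I)
  \<comment> \<open>Cancelling \<open>V\<close> leaves \<open>P V\<close>, and the trace condition
    turns the coefficient \<open>trace V / ?d\<close> into \<open>1 / \<gamma>\<close>.\<close>
  have "(V = V - P V + (trace V / ?d) *\<^sub>C mat 1 \<and> trace V = ?d / of_real \<gamma>) \<longleftrightarrow>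
      (P V = (1 / of_real \<gamma>) *\<^sub>C mat 1 \<and> trace V = ?d / of_real \<gamma>)"
    by (auto simp: algebra_simps)
  also have "\<dots> \<longleftrightarrow> V \<in> dual_affine S"
  proof
    assume V: "P V = (1 / of_real \<gamma>) *\<^sub>C mat 1 \<and> trace V = ?d / of_real \<gamma>"
    have "trace (dagger V ** W) = 1" if "W \<in> S" for W
    proof -
      \<comment> \<open>Since \<open>W = P W\<close>, self-adjointness moves \<open>P\<close> onto
        \<open>V\<close>.\<close>
      have "trace (dagger V ** W) = trace (dagger (P V) ** W)"
        using that S adj[of V W] by simp
      also have "\<dots> = 1"
        using V that S gamma by (simp add: trace_dagger_cscale_mult)
      finally show ?thesis .
    qed
    then show "V \<in> dual_affine S"
      by (simp add: dual_affine_def)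
  next
    assume "V \<in> dual_affine S"
    then have dual: "trace (dagger V ** W) = 1" if "W \<in> S" for W
      using that by (simp add: dual_affine_def)
    define W\<^sub>0 :: "complex^'n^'n" where "W\<^sub>0 = (of_real \<gamma> / ?d) *\<^sub>C mat 1"
    have W\<^sub>0: "W\<^sub>0 \<in> S"
      by (simp add: W\<^sub>0_def S scale unital trace_cscale trace_1)
    have "of_real \<gamma> / ?d * cnj (trace V) = 1"
      using dual[OF W\<^sub>0] by (simp add: W\<^sub>0_def trace_mult_cscale trace_dagger)
    then have "cnj (trace V) = ?d / of_real \<gamma>"
      using gamma by (simp add: field_simps)
    \<comment> \<open>The pairing is conjugate-linear in \<open>V\<close>; as
      \<open>?d / \<gamma>\<close> is real, conjugating again gives \<open>trace V\<close>
      itself.\<close>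
    then have "cnj (cnj (trace V)) = cnj (?d / of_real \<gamma>)"
      by (rule arg_cong)
    then have trV: "trace V = ?d / of_real \<gamma>"
      by simp
    define X where "X = P V + (- 1 / of_real \<gamma>) *\<^sub>C mat 1"
    have PX: "P X = X"
      using fun_cong[OF idempotent, of V] by (simp add: X_def add scale unital)
    \<comment> \<open>Pairing with the identity is the trace, and \<open>P\<close> fixes the
      identity.\<close>
    have "trace (P V) = trace V"
      using adj[of "mat 1" V] by (simp add: unital)
    then have trX: "trace X = 0"
      by (simp add: X_def trace_add trace_cscale trace_1 trV)
    have "P (W\<^sub>0 + X) = W\<^sub>0 + X" "trace (W\<^sub>0 + X) = of_real \<gamma>"
      using W\<^sub>0 PX trX by (simp_all add: S add trace_add)
    then have "trace (dagger V ** (W\<^sub>0 + X)) = 1"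
      using dual S by simp
    then have VX: "trace (dagger V ** X) = 0"
      using dual[OF W\<^sub>0] by (simp add: matrix_add_ldistrib trace_add)
    \<comment> \<open>Only the left factor is expanded: \<open>P X = X\<close> turns the first term
      into \<open>trace (dagger V ** X)\<close>, and the second is a multiple of
      \<open>trace X\<close>.\<close>
    have "trace (dagger X ** X)
        = trace (dagger (P V) ** X) + trace (dagger ((- 1 / of_real \<gamma>) *\<^sub>C mat 1) ** X)"
      by (subst (1) X_def) (rule trace_dagger_add_mult)
    also have "\<dots> = 0"
      using adj[of V X] VX PX trX by (simp add: trace_dagger_cscale_mult)
    finally have "X = 0"
      by (simp add: trace_dagger_self_eq_0_iff)
    then have "P V = (1 / of_real \<gamma>) *\<^sub>C mat 1"
      by (simp add: X_def vec_eq_iff)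
    with trV show "P V = (1 / of_real \<gamma>) *\<^sub>C mat 1 \<and> trace V = ?d / of_real \<gamma>"
      by simp
  qed
  finally show ?thesis
    by blast
qed

end
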